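(* Let $V$ be a separable Banach space, $\alpha,\beta\in(0,1)$ with $\alpha+\beta>1$, and let $A\in C^\alpha_tC^{1+\beta}_V$ be such that $\partial_tA$ exists and $\partial_tA\in C_b([0,T]\times V;V)$ (continuous and bounded). Then for any $x_0\in V$ there exists a unique global solution on $[0,T]$ to the YDE $x_t=x_0+\int_0^tA(\mathrm{d} s,x_s)$.
   Context: Fix $T>0$. For a path $f:[0,T]\to E$, $f_{s,t}=f_t-f_s$, $\llbracket f\rrbracket_\gamma=\sup_{s<t}\|f_{s,t}\|_E/|t-s|^\gamma$, $\|f\|_\gamma=\sup_t\|f_t\|_E+\llbracket f\rrbracket_\gamma$, $C^\gamma_tE$ the paths with $\|f\|_\gamma<\infty$. For $g:V\to W$, $\|g\|_\beta=\sup_{x\ne y}\|g(x)-g(y)\|_W/\|x-y\|_V^\beta+\sup_x\|g(x)\|_W$. Fields $A:[0,T]\times V\to V$ satisfy $A(0,\cdot)=0$, $A_{s,t}(x)=A(t,x)-A(s,x)$; $A\in C^\alpha_tC^\beta_V$ iff $\|A\|_{\alpha,\beta}=\sup_{s<t}\|A_{s,t}\|_\beta/|t-s|^\alpha<\infty$; $A\in C^\alpha_tC^{1+\beta}_V$ means in addition $A(t,\cdot)$ Fréchet differentiable with $DA\in C^\alpha_tC^\beta_{V,\mathcal L(V;V)}$. For $x\in C^\gamma_tV$ with $\alpha+\beta\gamma>1$, $\int_s^tA(\mathrm{d} r,x_r):=\lim_{|\Pi|\to0}\sum_iA_{t_i,t_{i+1}}(x_{t_i})$ over partitions of $[s,t]$.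 A solution on $[0,T]$ is $x\in C^\gamma([0,T];V)$, for some $\gamma$ with $\alpha+\beta\gamma>1$, satisfying the identity for all $t$. *)

theory Defs
  imports "HOL-Analysis.Analysis"
begin

definition holder_path :: "real \<Rightarrow> real \<Rightarrow> (real \<Rightarrow> 'e::real_normed_vector) \<Rightarrow> bool" where
  "holder_path T \<gamma> f \<longleftrightarrow>
     (\<exists>C. \<forall>t\<in>{0..T}. norm (f t) \<le> C) \<and>
     (\<exists>C. \<forall>s\<in>{0..T}. \<forall>t\<in>{0..T}. s < t \<longrightarrow> norm (f t - f s) \<le> C * (t - s) powr \<gamma>)"

definition field_holder ::
  "real \<Rightarrow> real \<Rightarrow> real \<Rightarrow> (real \<Rightarrow> 'v::real_normed_vector \<Rightarrow> 'w::real_normed_vector) \<Rightarrow> bool" where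
  "field_holder T \<alpha> \<beta> A \<longleftrightarrow>
     (\<exists>C. \<forall>s\<in>{0..T}. \<forall>t\<in>{0..T}. s < t \<longrightarrow>
        (\<forall>x. norm (A t x - A s x) \<le> C * (t - s) powr \<alpha>) \<and>
        (\<forall>x y. x \<noteq> y \<longrightarrow>
           norm ((A t x - A s x) - (A t y - A s y)) \<le> C * (t - s) powr \<alpha> * norm (x - y) powr \<beta>))"

definition field_holder_1 ::
  "real \<Rightarrow> real \<Rightarrow> real \<Rightarrow> (real \<Rightarrow> 'v::real_normed_vector \<Rightarrow> 'v) \<Rightarrow> bool" where
  "field_holder_1 T \<alpha> \<beta> A \<longleftrightarrow>
     field_holder T \<alpha> \<beta> A \<and>
     (\<exists>DA :: real \<Rightarrow> 'v \<Rightarrow> ('v \<Rightarrow>\<^sub>L 'v).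
        (\<forall>t\<in>{0..T}. \<forall>x. (A t has_derivative blinfun_apply (DA t x)) (at x)) \<and>
        field_holder T \<alpha> \<beta> DA)"

definition is_partition :: "real \<Rightarrow> real \<Rightarrow> real list \<Rightarrow> bool" where
  "is_partition s t ps \<longleftrightarrow> ps \<noteq> [] \<and> sorted_wrt (<) ps \<and> hd ps = s \<and> last ps = t"

definition mesh_less :: "real list \<Rightarrow> real \<Rightarrow> bool" where
  "mesh_less ps \<delta> \<longleftrightarrow> (\<forall>i. Suc i < length ps \<longrightarrow> ps ! Suc i - ps ! i < \<delta>)"

definition riemann_sum ::
  "(real \<Rightarrow> 'v \<Rightarrow> 'v::real_normed_vector) \<Rightarrow> (real \<Rightarrow> 'v) \<Rightarrow> real list \<Rightarrow> 'v" where
  "riemann_sum A x ps =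
     (\<Sum>i<length ps - 1. A (ps ! Suc i) (x (ps ! i)) - A (ps ! i) (x (ps ! i)))"

definition young_integral_is ::
  "(real \<Rightarrow> 'v \<Rightarrow> 'v::real_normed_vector) \<Rightarrow> (real \<Rightarrow> 'v) \<Rightarrow> real \<Rightarrow> real \<Rightarrow> 'v \<Rightarrow> bool" where
  "young_integral_is A x s t I \<longleftrightarrow>
     (\<forall>\<epsilon>>0. \<exists>\<delta>>0. \<forall>ps. is_partition s t ps \<and> mesh_less ps \<delta> \<longrightarrow>
        norm (riemann_sum A x ps - I) < \<epsilon>)"

definition yde_solution ::
  "real \<Rightarrow> real \<Rightarrow> real \<Rightarrow> (real \<Rightarrow> 'v \<Rightarrow> 'v::real_normed_vector) \<Rightarrow> 'v \<Rightarrow> (real \<Rightarrow> 'v) \<Rightarrow> bool" where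
  "yde_solution T \<alpha> \<beta> A x0 x \<longleftrightarrow>
     (\<exists>\<gamma>. 0 < \<gamma> \<and> \<gamma> \<le> 1 \<and> \<alpha> + \<beta> * \<gamma> > 1 \<and> holder_path T \<gamma> x) \<and>
     (\<forall>t\<in>{0..T}. young_integral_is A x 0 t (x t - x0))"

end

theory Submission
  imports Defs
begin

text \<open>Since \<open>\<partial>\<^sub>tA\<close> is bounded and continuous, Young integrals of \<open>A\<close> along continuous paths are Riemann
  integrals of \<open>\<partial>\<^sub>tA\<close> and hence Lipschitz in time, so every solution is Lipschitz. Interpolating
  \<open>A \<in> Lip\<^sub>t C\<^sup>0\<close> with \<open>A \<in> C\<^sup>\<alpha>\<^sub>t C\<^sup>1\<^sup>+\<^sup>\<beta>\<close> bounds the spatial Lipschitz constant of \<open>A\<^sub>s\<^sub>,\<^sub>t\<close> by a multiple of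
  \<open>(t - s) powr \<kappa>\<close> with \<open>\<kappa> = (\<alpha> + \<beta>) / (1 + \<beta>)\<close>. As \<open>2 \<kappa> \<ge> \<alpha> + \<beta> > 1\<close>, the difference of two Lipschitz
  paths can be estimated in the \<open>\<kappa>\<close>-Hoelder seminorm by sewing, and Picard iteration is a
  contraction in that seminorm on short intervals. This gives existence without compactness, and
  uniqueness. The exponent \<open>\<alpha>\<close> itself would not do for sewing when \<open>\<alpha> \<le> 1/2\<close>.\<close>

section \<open>Sewing and finite differences\<close>

text \<open>Repeated halving of \<open>[s, t]\<close> turns the midpoint defects into a geometric
  series of ratio \<open>2 powr (1 - \<theta>)\<close>, and \<open>small\<close> controls what is
  left on the finest intervals. In the applications \<open>R\<close> is the norm of the error in
  approximating an increment of a path.\<close>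

lemma dyadic_sewing:
  fixes R :: "real \<Rightarrow> real \<Rightarrow> real"
  assumes \<theta>: "\<theta> > 1"
    and mid: "\<And>s t. a \<le> s \<Longrightarrow> s \<le> t \<Longrightarrow> t \<le> b \<Longrightarrow>
      R s t \<le> R s ((s + t) / 2) + R ((s + t) / 2) t + K * (t - s) powr \<theta>"
    and small: "\<And>\<epsilon>. \<epsilon> > 0 \<Longrightarrow>
      \<exists>\<delta>>0. \<forall>s t. a \<le> s \<longrightarrow> s \<le> t \<longrightarrow> t \<le> b \<longrightarrow> t - s < \<delta> \<longrightarrow> R s t \<le> \<epsilon> * (t - s)"
    and K: "K \<ge> 0"
    and st: "a \<le> s" "s \<le> t" "t \<le> b"
  shows "R s t \<le> K / (1 - 2 powr (1 - \<theta>)) * (t - s) powr \<theta>"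
proof -
  define c where "c = 1 / (1 - 2 powr (1 - \<theta>))"
  have lt: "2 powr (1 - \<theta>) < 1"
    using \<theta> by (simp add: powr_less_one)
  have c0: "c \<ge> 0" using lt by (simp add: c_def)
  \<comment> \<open>\<open>c\<close> is the sum of that series, hence the fixed point that closes
    the induction on the number of halvings.\<close>
  have c1: "c * 2 powr (1 - \<theta>) + 1 = c"
    using lt \<theta> by (simp add: c_def divide_simps)
  have approx: "R s t \<le> c * K * (t - s) powr \<theta> + \<epsilon> * (t - s)" if \<epsilon>: "\<epsilon> > 0" for \<epsilon>
  proof -
    obtain \<delta> where \<delta>: "\<delta> > 0"
      "\<And>s t. a \<le> s \<Longrightarrow> s \<le> t \<Longrightarrow> t \<le> b \<Longrightarrow> t - s < \<delta> \<Longrightarrow> R s t \<le> \<epsilon> * (t - s)"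
      using small[OF \<epsilon>] by blast
    have *: "R s t \<le> c * K * (t - s) powr \<theta> + \<epsilon> * (t - s)"
      if "a \<le> s" "s \<le> t" "t \<le> b" "t - s < \<delta> * 2 ^ n" for n s t
      using that
    proof (induction n arbitrary: s t)
      case 0
      then have "R s t \<le> \<epsilon> * (t - s)" using \<delta>(2) by simp
      moreover have "0 \<le> c * K * (t - s) powr \<theta>" using c0 K by simp
      ultimately show ?case by linarith
    next
      case (Suc n)
      define m where "m = (s + t) / 2"
      have m: "s \<le> m" "m \<le> t" "m - s = (t - s) / 2" "t - m = (t - s) / 2"
        using Suc.prems by (auto simp: m_def field_simps)
      have "R s m \<le> c * K * (m - s) powr \<theta> + \<epsilon> * (m - s)"
        by (rule Suc.IH) (use Suc.prems m in auto)
      moreover have "R m t \<le> c * K * (t - m) powr \<theta> + \<epsilon> * (t - m)"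
        by (rule Suc.IH) (use Suc.prems m in auto)
      moreover have "R s t \<le> R s m + R m t + K * (t - s) powr \<theta>"
        using mid[of s t] Suc.prems by (simp add: m_def)
      moreover have "2 * (((t - s) / 2) powr \<theta>) = 2 powr (1 - \<theta>) * (t - s) powr \<theta>"
        using Suc.prems by (simp add: powr_divide powr_diff)
      then have "c * K * ((t - s) / 2) powr \<theta> + c * K * ((t - s) / 2) powr \<theta> + K * (t - s) powr \<theta>
          = K * (t - s) powr \<theta> * (c * 2 powr (1 - \<theta>) + 1)"
        by algebra
      then have "c * K * ((t - s) / 2) powr \<theta> + c * K * ((t - s) / 2) powr \<theta> + K * (t - s) powr \<theta>
          = c * K * (t - s) powr \<theta>"
        unfolding c1 by simp
      moreover have "\<epsilon> * ((t - s) / 2) + \<epsilon> * ((t - s) / 2) = \<epsilon> * (t - s)" by simp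
      ultimately show ?case
        unfolding m(3,4) by linarith
    qed
    obtain n :: nat where "(t - s) / \<delta> < 2 ^ n"
      using real_arch_pow[of 2 "(t - s) / \<delta>"] by auto
    then have "t - s < \<delta> * 2 ^ n" using \<delta>(1) by (simp add: field_simps)
    with * st show ?thesis by blast
  qed
  have "R s t \<le> c * K * (t - s) powr \<theta>"
  proof (rule field_le_epsilon)
    fix e :: real assume e: "e > 0"
    \<comment> \<open>The denominator \<open>t - s + 1\<close> stays positive when
      \<open>s = t\<close>.\<close>
    have "e / (t - s + 1) * (t - s) \<le> e"
      using e st by (simp add: field_simps)
    with approx[of "e / (t - s + 1)"] e st show "R s t \<le> c * K * (t - s) powr \<theta> + e"
      by auto
  qed
  then show ?thesis by (simp add: c_def)
qed

section \<open>Finite differences of maps with a Hoelder continuous derivative\<close>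

text \<open>Compare \<open>DF x v\<close> with \<open>F (x + v) - F x\<close> on the sphere
  \<open>norm v = \<rho>\<close>: the first-order remainder is at most
  \<open>b * \<rho> powr \<beta> * \<rho>\<close>, and scaling by \<open>1 / \<rho>\<close> gives
  the two terms. The radius stays free so that they can be balanced later.\<close>

lemma derivative_bound_interpolation:
  fixes F :: "'v::real_normed_vector \<Rightarrow> 'w::real_normed_vector" and DF :: "'v \<Rightarrow> 'v \<Rightarrow>\<^sub>L 'w"
  assumes der: "\<And>x. (F has_derivative blinfun_apply (DF x)) (at x)"
    and bd: "\<And>x y. norm (F x - F y) \<le> a"
    and hol: "\<And>x y. norm (DF x - DF y) \<le> b * norm (x - y) powr \<beta>"
    and \<beta>: "\<beta> > 0" and b: "b \<ge> 0" and \<rho>: "\<rho> > 0"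
  shows "norm (DF x) \<le> a / \<rho> + b * \<rho> powr \<beta>"
proof (rule norm_blinfun_bound)
  have a: "a \<ge> 0" using bd[of x x] by simp
  then show "0 \<le> a / \<rho> + b * \<rho> powr \<beta>" using b \<rho> by simp
  have unit: "norm (DF x v) \<le> a + b * \<rho> powr \<beta> * \<rho>" if v: "norm v = \<rho>" for v
  proof -
    \<comment> \<open>Mean value inequality for \<open>F - DF x\<close>, whose derivative
      \<open>DF y - DF x\<close> is small along the segment.\<close>
    have "norm ((F (x + v) - DF x (x + v)) - (F x - DF x x)) \<le> b * \<rho> powr \<beta> * norm ((x + v) - x)"
    proof (rule differentiable_bound[where f' = "\<lambda>y. blinfun_apply (DF y - DF x)" and S = "closed_segment x (x + v)"])
      fix y assume y: "y \<in> closed_segment x (x + v)"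
      have "(F has_derivative blinfun_apply (DF y)) (at y within closed_segment x (x + v))"
        by (rule has_derivative_at_withinI[OF der])
      then show "((\<lambda>y. F y - DF x y) has_derivative blinfun_apply (DF y - DF x)) (at y within closed_segment x (x + v))"
        by (auto intro!: derivative_eq_intros simp: blinfun.bilinear_simps)
      have "norm (y - x) \<le> \<rho>"
        using segment_bound(1)[OF y] v by (simp add: norm_minus_commute)
      then have "b * norm (y - x) powr \<beta> \<le> b * \<rho> powr \<beta>"
        using b \<beta> by (intro mult_left_mono powr_mono2) auto
      then show "onorm (blinfun_apply (DF y - DF x)) \<le> b * \<rho> powr \<beta>"
        using hol[of y x] by (simp add: norm_blinfun.rep_eq)
    qed auto
    then have "norm ((F (x + v) - F x) - DF x v) \<le> b * \<rho> powr \<beta> * \<rho>"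
      using v by (simp add: blinfun.bilinear_simps algebra_simps)
    moreover have "norm (DF x v) \<le> norm (F (x + v) - F x) + norm ((F (x + v) - F x) - DF x v)"
      by (metis norm_minus_commute norm_triangle_sub)
    ultimately show ?thesis using bd[of "x + v" x] by linarith
  qed
  show "norm (DF x v) \<le> (a / \<rho> + b * \<rho> powr \<beta>) * norm v" for v
  proof (cases "v = 0")
    case False
    define k where "k = \<rho> / norm v"
    have k: "k > 0" using False \<rho> by (simp add: k_def)
    have "norm (k *\<^sub>R v) = \<rho>" using False \<rho> by (simp add: k_def)
    from unit[OF this] have "k * norm (DF x v) \<le> a + b * \<rho> powr \<beta> * \<rho>"
      using k by (simp add: blinfun.bilinear_simps)
    then have "norm (DF x v) \<le> (a + b * \<rho> powr \<beta> * \<rho>) / k"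
      using k by (simp add: field_simps)
    also have "\<dots> = (a / \<rho> + b * \<rho> powr \<beta>) * norm v"
      using \<rho> False by (simp add: k_def field_simps)
    finally show ?thesis .
  qed simp
qed

text \<open>Complete \<open>y\<close>, \<open>x'\<close>, \<open>y'\<close> to a parallelogram with
  fourth vertex \<open>y + (x' - y')\<close>. Moving \<open>x\<close> to this vertex costs the
  Lipschitz term. What remains is the increment of \<open>F (y + z) - F (y' + z)\<close> from
  \<open>z = 0\<close> to \<open>z = x' - y'\<close>, and the Hoelder bound on \<open>DF\<close>
  controls the derivative of this map in \<open>z\<close>.\<close>

lemma four_point_estimate:
  fixes F :: "'v::real_normed_vector \<Rightarrow> 'w::real_normed_vector" and DF :: "'v \<Rightarrow> 'v \<Rightarrow>\<^sub>L 'w"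
  assumes der: "\<And>x. (F has_derivative blinfun_apply (DF x)) (at x)"
    and lip: "\<And>x y. norm (F x - F y) \<le> d * norm (x - y)"
    and hol: "\<And>x y. norm (DF x - DF y) \<le> b * norm (x - y) powr \<beta>"
  shows "norm ((F x - F y) - (F x' - F y')) \<le>
    d * norm ((x - y) - (x' - y')) + b * norm (y - y') powr \<beta> * norm (x' - y')"
proof -
  let ?w = "x' - y'"
  have "norm ((F (y + ?w) - F (y' + ?w)) - (F (y + 0) - F (y' + 0))) \<le>
      b * norm (y - y') powr \<beta> * norm (?w - 0)"
  proof (rule differentiable_bound[where f' = "\<lambda>z. blinfun_apply (DF (y + z) - DF (y' + z))" and S = UNIV])
    fix z :: 'v
    have "((\<lambda>z. F (c + z)) has_derivative blinfun_apply (DF (c + z))) (at z)" for c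
    proof -
      have "((\<lambda>z. c + z) has_derivative (\<lambda>z. z)) (at z)"
        by (auto intro!: derivative_eq_intros)
      from has_derivative_compose[OF this der] show ?thesis .
    qed
    from has_derivative_diff[OF this[of y] this[of y']]
    show "((\<lambda>z. F (y + z) - F (y' + z)) has_derivative blinfun_apply (DF (y + z) - DF (y' + z))) (at z)"
      by (simp add: minus_blinfun.rep_eq)
    show "onorm (blinfun_apply (DF (y + z) - DF (y' + z))) \<le> b * norm (y - y') powr \<beta>"
      using hol[of "y + z" "y' + z"] by (simp add: norm_blinfun.rep_eq)
  qed auto
  then have 1: "norm (F (y + ?w) - F y - (F x' - F y')) \<le> b * norm (y - y') powr \<beta> * norm ?w"
    by (simp add: algebra_simps)
  have 2: "norm (F x - F (y + ?w)) \<le> d * norm ((x - y) - ?w)"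
    using lip[of x "y + ?w"] by (simp add: algebra_simps)
  have "(F x - F y) - (F x' - F y') = (F x - F (y + ?w)) + (F (y + ?w) - F y - (F x' - F y'))"
    by simp
  then show ?thesis using 1 2 norm_triangle_mono by metis
qed

section \<open>Young integrals and Hoelder paths\<close>

text \<open>Partitions of arbitrarily small mesh exist, so the defining condition is not vacuous;
  one partition that is fine enough for both limits then compares them.\<close>

lemma young_integral_unique:
  assumes "s \<le> t" "young_integral_is A x s t I" "young_integral_is A x s t J"
  shows "I = J"
proof -
  have partition: "\<exists>ps. is_partition s t ps \<and> mesh_less ps \<delta>" if \<delta>: "\<delta> > 0" for \<delta>
  proof (cases "s = t")
    case True
    \<comment> \<open>Partitions increase strictly, so a one-point interval admits only
      \<open>[s]\<close>, with an empty Riemann sum.\<close>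
    then have "is_partition s t [s] \<and> mesh_less [s] \<delta>"
      by (simp add: is_partition_def mesh_less_def)
    then show ?thesis ..
  next
    case False
    with assms have st: "s < t" by simp
    obtain n :: nat where n: "(t - s) / \<delta> < real n"
      using reals_Archimedean2 by blast
    have "(t - s) / \<delta> > 0" using st \<delta> by simp
    with n have n0: "real n > 0" by linarith
    define p where "p i = s + (t - s) * (real i / real n)" for i
    let ?ps = "map p [0..<Suc n]"
    have mono: "p i < p j" if "i < j" for i j
      using that st n0 by (simp add: p_def divide_strict_right_mono)
    have "?ps \<noteq> []" by simp
    moreover have "sorted_wrt (<) ?ps"
      by (simp add: sorted_wrt_iff_nth_less mono del: upt_Suc)
    moreover have "hd ?ps = s"
      using n0 by (simp add: hd_map p_def del: upt_Suc)
    moreover have "last ?ps = t"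
      using n0 by (simp add: p_def)
    moreover have "mesh_less ?ps \<delta>"
      unfolding mesh_less_def
    proof (intro allI impI)
      fix i assume "Suc i < length ?ps"
      then have i: "Suc i < Suc n" by simp
      have "p (Suc i) - p i = (t - s) / n"
        using n0 by (simp add: p_def field_simps)
      also have "\<dots> < \<delta>" using n n0 \<delta> by (simp add: field_simps)
      finally show "?ps ! Suc i - ?ps ! i < \<delta>"
        using i by (simp del: upt_Suc)
    qed
    ultimately have "is_partition s t ?ps \<and> mesh_less ?ps \<delta>"
      unfolding is_partition_def by blast
    then show ?thesis ..
  qed
  have "norm (I - J) \<le> e" if e: "e > 0" for e
  proof -
    obtain \<delta>1 where 1: "\<delta>1 > 0" "\<And>ps. is_partition s t ps \<Longrightarrow> mesh_less ps \<delta>1 \<Longrightarrow> norm (riemann_sum A x ps - I) < e / 2"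
      using assms(2) e unfolding young_integral_is_def by (meson half_gt_zero)
    obtain \<delta>2 where 2: "\<delta>2 > 0" "\<And>ps. is_partition s t ps \<Longrightarrow> mesh_less ps \<delta>2 \<Longrightarrow> norm (riemann_sum A x ps - J) < e / 2"
      using assms(3) e unfolding young_integral_is_def by (meson half_gt_zero)
    obtain ps where "is_partition s t ps" "mesh_less ps (min \<delta>1 \<delta>2)"
      using partition[of "min \<delta>1 \<delta>2"] 1 2 by auto
    then have "norm (riemann_sum A x ps - I) < e / 2" "norm (riemann_sum A x ps - J) < e / 2"
      using 1(2) 2(2) by (auto simp: mesh_less_def)
    moreover have "norm (I - J) \<le> norm (riemann_sum A x ps - I) + norm (riemann_sum A x ps - J)"
      by (metis dist_norm dist_triangle3)
    ultimately show ?thesis by linarith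
  qed
  then have "norm (I - J) \<le> 0" using field_le_epsilon[of "norm (I - J)" 0] by simp
  then show ?thesis by simp
qed

lemma mult_powr_less:
  fixes K \<gamma> \<epsilon> :: real
  assumes "\<epsilon> > 0" "K \<ge> 0" "\<gamma> > 0"
  shows "\<exists>\<delta>>0. \<forall>h. 0 \<le> h \<longrightarrow> h < \<delta> \<longrightarrow> K * h powr \<gamma> < \<epsilon>"
proof -
  \<comment> \<open>This is the solution \<open>h\<close> of
    \<open>(K + 1) * h powr \<gamma> = \<epsilon>\<close>; the summand 1 covers
    \<open>K = 0\<close>.\<close>
  define \<delta> where "\<delta> = (\<epsilon> / (K + 1)) powr (1 / \<gamma>)"
  have "K * h powr \<gamma> < \<epsilon>" if h: "0 \<le> h" "h < \<delta>" for h
  proof -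
    have "h powr \<gamma> < \<delta> powr \<gamma>" using h assms by (intro powr_less_mono2) auto
    also have "\<delta> powr \<gamma> = \<epsilon> / (K + 1)" using assms by (simp add: \<delta>_def powr_powr)
    finally have "(K + 1) * h powr \<gamma> < \<epsilon>" using assms by (simp add: field_simps)
    then show ?thesis using powr_ge_zero[of h \<gamma>] by (simp only: distrib_right mult_1_left)
  qed
  moreover have "\<delta> > 0" using assms by (simp add: \<delta>_def)
  ultimately show ?thesis by blast
qed

lemma holder_path_continuous:
  assumes "holder_path T \<gamma> x" "\<gamma> > 0"
  shows "continuous_on {0..T} x"
proof -
  obtain K where K: "\<And>s t. s \<in> {0..T} \<Longrightarrow> t \<in> {0..T} \<Longrightarrow> s < t \<Longrightarrow> norm (x t - x s) \<le> K * (t - s) powr \<gamma>"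
    using assms(1) unfolding holder_path_def by blast
  have *: "norm (x t - x s) \<le> \<bar>K\<bar> * (t - s) powr \<gamma>"
    if st: "s \<in> {0..T}" "t \<in> {0..T}" "s \<le> t" for s t
  proof (cases "s = t")
    case False
    then have "norm (x t - x s) \<le> K * (t - s) powr \<gamma>" using K st by simp
    also have "\<dots> \<le> \<bar>K\<bar> * (t - s) powr \<gamma>" by (intro mult_right_mono) auto
    finally show ?thesis .
  qed simp
  have dist_x: "dist (x t) (x s) \<le> \<bar>K\<bar> * dist t s powr \<gamma>" if "s \<in> {0..T}" "t \<in> {0..T}" for s t
  proof (cases "s \<le> t")
    case True
    then show ?thesis using *[of s t] that by (simp add: dist_norm)
  next
    case False
    then show ?thesis using *[of t s] that by (simp add: dist_norm norm_minus_commute)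
  qed
  show ?thesis
    unfolding continuous_on_iff
  proof (intro ballI allI impI)
    fix s e :: real assume s: "s \<in> {0..T}" and "0 < e"
    then obtain d where "d > 0" "\<And>h. 0 \<le> h \<Longrightarrow> h < d \<Longrightarrow> \<bar>K\<bar> * h powr \<gamma> < e"
      using mult_powr_less[of e "\<bar>K\<bar>" \<gamma>] assms(2) by auto
    then show "\<exists>d>0. \<forall>t\<in>{0..T}. dist t s < d \<longrightarrow> dist (x t) (x s) < e"
      using dist_x[OF s] by (meson le_less_trans zero_le_dist)
  qed
qed

text \<open>On the \<open>j\<close>-th interval of length \<open>\<tau>\<close> the Hoelder constant may grow like \<open>L\<^sup>j\<close>. This weight
  makes Picard iteration contract on all of \<open>[0, T]\<close> at once, without gluing local solutions.\<close>

definition weighted_holder ::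
  "real \<Rightarrow> real \<Rightarrow> real \<Rightarrow> real \<Rightarrow> real \<Rightarrow> (real \<Rightarrow> 'v::real_normed_vector) \<Rightarrow> bool" where
  "weighted_holder T \<gamma> \<tau> L B v \<longleftrightarrow>
     (\<forall>j s u. real j * \<tau> \<le> s \<longrightarrow> s \<le> u \<longrightarrow> u \<le> (real j + 1) * \<tau> \<longrightarrow> u \<le> T \<longrightarrow>
        norm (v u - v s) \<le> B * L ^ j * (u - s) powr \<gamma>)"

text \<open>The increments over the cells before the \<open>j\<close>-th form a geometric sum, since
  \<open>\<tau> \<le> 1\<close> bounds the \<open>i\<close>-th one by \<open>B * L ^ i\<close>. The
  factor \<open>1 / (L - 1)\<close> matters: for large \<open>L\<close> the value at the start of a
  cell is small against the Hoelder constant \<open>B * L ^ j\<close> of that cell.\<close>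

lemma weighted_holder_grid_bound:
  assumes v: "weighted_holder T \<gamma> \<tau> L B v" "v 0 = 0"
    and \<tau>: "0 < \<tau>" "\<tau> \<le> 1" and \<gamma>: "\<gamma> > 0" and L: "L > 1" and B: "B \<ge> 0"
  shows "real j * \<tau> \<le> T \<Longrightarrow> norm (v (real j * \<tau>)) \<le> B * L ^ j / (L - 1)"
proof (induction j)
  case 0
  then show ?case using v B L by simp
next
  case (Suc j)
  have j: "real j * \<tau> \<le> real (Suc j) * \<tau>" using \<tau> by (simp add: algebra_simps)
  have "norm (v (real (Suc j) * \<tau>) - v (real j * \<tau>)) \<le> B * L ^ j * (real (Suc j) * \<tau> - real j * \<tau>) powr \<gamma>"
    using v(1)[unfolded weighted_holder_def, rule_format, of j "real j * \<tau>" "real (Suc j) * \<tau>"] j Suc.prems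
    by (simp add: add.commute)
  also have "real (Suc j) * \<tau> - real j * \<tau> = \<tau>" by (simp add: algebra_simps)
  also have "B * L ^ j * \<tau> powr \<gamma> \<le> B * L ^ j * 1"
    using \<tau> \<gamma> B L by (intro mult_left_mono powr_le1) auto
  finally have "norm (v (real (Suc j) * \<tau>) - v (real j * \<tau>)) \<le> B * L ^ j" by simp
  moreover have "norm (v (real j * \<tau>)) \<le> B * L ^ j / (L - 1)"
    using Suc j by simp
  moreover have "norm (v (real (Suc j) * \<tau>)) \<le>
      norm (v (real j * \<tau>)) + norm (v (real (Suc j) * \<tau>) - v (real j * \<tau>))"
    by (rule norm_triangle_sub)
  moreover have "B * L ^ j / (L - 1) + B * L ^ j = B * L ^ Suc j / (L - 1)"
    using L by (simp add: field_simps)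
  ultimately show ?case by linarith
qed

lemma grid_cell:
  fixes \<tau> s :: real
  assumes "\<tau> > 0" "s \<ge> 0"
  obtains j where "real j * \<tau> \<le> s" "s \<le> (real j + 1) * \<tau>"
proof
  let ?j = "nat \<lfloor>s / \<tau>\<rfloor>"
  have j: "real ?j = of_int \<lfloor>s / \<tau>\<rfloor>" using assms by simp
  show "real ?j * \<tau> \<le> s" unfolding j using assms by (simp add: pos_le_divide_eq[symmetric])
  have "s / \<tau> \<le> real ?j + 1" unfolding j by linarith
  then show "s \<le> (real ?j + 1) * \<tau>" using pos_divide_le_eq[OF assms(1)] by blast
qed

text \<open>\<open>G\<close> depends on neither \<open>B\<close> nor \<open>v\<close>, so geometric
  decay of the weighted seminorm becomes geometric decay of the sup norm on
  \<open>[0, T]\<close>.\<close>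

lemma weighted_holder_bound:
  assumes \<tau>: "0 < \<tau>" "\<tau> \<le> 1" and \<gamma>: "\<gamma> > 0" and L: "L > 1" and T: "T > 0"
  shows "\<exists>G. \<forall>B v. B \<ge> 0 \<longrightarrow> weighted_holder T \<gamma> \<tau> L B v \<longrightarrow> v 0 = 0 \<longrightarrow>
    (\<forall>s\<in>{0..T}. norm (v s) \<le> B * G)"
proof -
  \<comment> \<open>\<open>J\<close> exceeds the index of every cell that meets
    \<open>[0, T]\<close>.\<close>
  obtain J :: nat where J: "T / \<tau> < real J" using reals_Archimedean2 by blast
  have "norm (v s) \<le> B * (L ^ J * (1 / (L - 1) + 1))"
    if B: "B \<ge> 0" and v: "weighted_holder T \<gamma> \<tau> L B v" "v 0 = 0" and s: "s \<in> {0..T}" for B v s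
  proof -
    obtain j where j: "real j * \<tau> \<le> s" "s \<le> (real j + 1) * \<tau>"
      using grid_cell[of \<tau> s] \<tau> s by auto
    have "norm (v s) \<le> norm (v (real j * \<tau>)) + norm (v s - v (real j * \<tau>))"
      by (rule norm_triangle_sub)
    also have "\<dots> \<le> B * L ^ j / (L - 1) + B * L ^ j * (s - real j * \<tau>) powr \<gamma>"
      using weighted_holder_grid_bound[OF v \<tau> \<gamma> L B, of j]
        v(1)[unfolded weighted_holder_def, rule_format, of j "real j * \<tau>" s] j s by (intro add_mono) auto
    also have "\<dots> \<le> B * L ^ j / (L - 1) + B * L ^ j * 1"
      using j \<tau> \<gamma> B L by (intro add_left_mono mult_left_mono powr_le1) (auto simp: algebra_simps)
    also have "\<dots> = L ^ j * (B * (1 / (L - 1) + 1))"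
      using L by (simp add: field_simps)
    also have "\<dots> \<le> L ^ J * (B * (1 / (L - 1) + 1))"
    proof (intro mult_right_mono power_increasing)
      have "real j * \<tau> \<le> T" using j s by simp
      then have "real j \<le> T / \<tau>" using \<tau> by (simp add: pos_le_divide_eq)
      with J show "j \<le> J" by linarith
    qed (use B L in auto)
    finally show ?thesis by (simp add: mult_ac)
  qed
  then show ?thesis by blast
qed

section \<open>Fields with bounded continuous time derivative\<close>

locale time_regular_field =
  fixes T \<alpha> \<beta> M C :: real
    and A dA :: "real \<Rightarrow> 'v::banach \<Rightarrow> 'v"
    and DA :: "real \<Rightarrow> 'v \<Rightarrow> 'v \<Rightarrow>\<^sub>L 'v"
  assumes T: "T > 0"
    and \<alpha>\<beta>: "0 < \<alpha>" "\<alpha> < 1" "0 < \<beta>" "\<beta> < 1" "\<alpha> + \<beta> > 1"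
    and M: "M > 0" and C: "C \<ge> 0"
    and space_derivative: "\<And>t x. 0 \<le> t \<Longrightarrow> t \<le> T \<Longrightarrow> (A t has_derivative blinfun_apply (DA t x)) (at x)"
    and DA_holder: "\<And>s t x y. 0 \<le> s \<Longrightarrow> s \<le> t \<Longrightarrow> t \<le> T \<Longrightarrow>
      norm ((DA t x - DA s x) - (DA t y - DA s y)) \<le> C * (t - s) powr \<alpha> * norm (x - y) powr \<beta>"
    and time_derivative: "\<And>t x. t \<in> {0..T} \<Longrightarrow>
      ((\<lambda>r. A r x) has_vector_derivative dA t x) (at t within {0..T})"
    and dA_continuous: "continuous_on ({0..T} \<times> UNIV) (\<lambda>(t, x). dA t x)"
    and dA_bound: "\<And>t x. t \<in> {0..T} \<Longrightarrow> norm (dA t x) \<le> M"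
begin

definition \<kappa> where "\<kappa> = (\<alpha> + \<beta>) / (1 + \<beta>)"

text \<open>Chosen so that \<open>2 * D * (t - s) powr \<kappa>\<close> is a spatial Lipschitz
  constant of \<open>incr s t\<close>: interpolation yields \<open>2 * M + C\<close>, which is at
  most \<open>2 * D\<close>.\<close>

definition D where "D = M + C"

definition incr where "incr s t x = A t x - A s x"

text \<open>\<open>germ z x\<close> says that \<open>x\<close> is a primitive of \<open>A(ds, z\<^sub>s)\<close>.\<close>

definition germ :: "(real \<Rightarrow> 'v) \<Rightarrow> (real \<Rightarrow> 'v) \<Rightarrow> bool" where
  "germ z x \<longleftrightarrow> (\<forall>\<epsilon>>0. \<exists>\<delta>>0. \<forall>s t. 0 \<le> s \<longrightarrow> s \<le> t \<longrightarrow> t \<le> T \<longrightarrow> t - s < \<delta> \<longrightarrow>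
     norm (x t - x s - incr s t (z s)) \<le> \<epsilon> * (t - s))"

text \<open>The constant is the bound \<open>M\<close> of the time derivative, so primitives along
  any continuous path can be taken in this class, and Picard iteration stays inside it.\<close>

definition lip :: "(real \<Rightarrow> 'v) \<Rightarrow> bool" where
  "lip x \<longleftrightarrow> (\<forall>s t. 0 \<le> s \<longrightarrow> s \<le> t \<longrightarrow> t \<le> T \<longrightarrow> norm (x t - x s) \<le> M * (t - s))"

text \<open>\<open>\<kappa> < 1\<close> comes from \<alpha> < 1, and the last bound from 1 + \<beta>
  \<le> 2. The identity splits the sewing exponent \<alpha> + \<beta> into \<kappa> and the gain
  \<open>\<kappa> * \<beta>\<close>, which makes short intervals contract.\<close>

lemma \<kappa>: "0 < \<kappa>" "\<kappa> < 1" "\<kappa> * (1 + \<beta>) = \<alpha> + \<beta>" "\<alpha> + \<beta> \<le> 2 * \<kappa>"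
proof -
  show "0 < \<kappa>" "\<kappa> < 1" "\<kappa> * (1 + \<beta>) = \<alpha> + \<beta>" using \<alpha>\<beta> by (auto simp: \<kappa>_def)
  then show "\<alpha> + \<beta> \<le> 2 * \<kappa>" using \<alpha>\<beta> by (metis add.commute add_mono_thms_linordered_field(1) less_eq_real_def mult.commute mult_le_cancel_left_pos one_add_one)
qed

lemma D: "D > 0" using M C by (simp add: D_def)

lemma dA_integral:
  assumes "0 \<le> s" "s \<le> t" "t \<le> T"
  shows "((\<lambda>r. dA r x) has_integral incr s t x) {s..t}"
  unfolding incr_def
proof (rule fundamental_theorem_of_calculus)
  fix r assume "r \<in> {s..t}"
  with assms time_derivative[of r x] show "((\<lambda>r. A r x) has_vector_derivative dA r x) (at r within {s..t})"
    by (auto intro: has_vector_derivative_within_subset)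
qed (use assms in auto)

lemma continuous_on_dA:
  assumes "continuous_on S f" "continuous_on S g" "f ` S \<subseteq> {0..T}"
  shows "continuous_on S (\<lambda>p. dA (f p) (g p))"
proof -
  have "continuous_on S (\<lambda>p. (\<lambda>(t, x). dA t x) (f p, g p))"
    by (rule continuous_on_compose2[OF dA_continuous]) (use assms in \<open>auto intro!: continuous_intros\<close>)
  then show ?thesis by simp
qed

lemma incr_bound:
  assumes "0 \<le> s" "s \<le> t" "t \<le> T"
  shows "norm (incr s t x) \<le> M * (t - s)"
proof -
  have "continuous_on {s..t} (\<lambda>r. dA r x)"
    by (rule continuous_on_dA) (use assms in \<open>auto intro!: continuous_intros\<close>)
  then have "norm (integral {s..t} (\<lambda>r. dA r x)) \<le> M * (t - s)"
    by (rule integral_bound[rotated]) (use assms dA_bound in auto)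
  then show ?thesis using dA_integral[OF assms, of x] by (simp add: integral_unique)
qed

lemma incr_derivative:
  assumes "0 \<le> s" "s \<le> t" "t \<le> T"
  shows "(incr s t has_derivative blinfun_apply (DA t x - DA s x)) (at x)"
  unfolding incr_def[abs_def]
  using has_derivative_diff[OF space_derivative[of t x] space_derivative[of s x]] assms
  by (simp add: minus_blinfun.rep_eq)

text \<open>Interpolating between \<open>\<bar>A\<^sub>s\<^sub>,\<^sub>t\<bar> \<le> M h\<close> and \<open>[DA\<^sub>s\<^sub>,\<^sub>t]\<^sub>\<beta> \<le> C h\<^sup>\<alpha>\<close>, where \<open>h = t - s\<close>, at the
  spatial scale \<open>\<rho> = h powr ((1 - \<alpha>) / (1 + \<beta>))\<close> improves the exponent \<open>\<alpha>\<close> of the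
  Lipschitz constant to \<open>\<kappa> > 1/2\<close>.\<close>

lemma incr_lipschitz:
  assumes st: "0 \<le> s" "s \<le> t" "t \<le> T"
  shows "norm (incr s t x - incr s t y) \<le> 2 * D * (t - s) powr \<kappa> * norm (x - y)"
proof (cases "s = t")
  case True
  then show ?thesis by (simp add: incr_def)
next
  case False
  define h where "h = t - s"
  have h: "h > 0" using False st by (simp add: h_def)
  define e where "e = (1 - \<alpha>) / (1 + \<beta>)"
  \<comment> \<open>This exponent gives both terms of the interpolation the same power of
    \<open>h\<close>.\<close>
  have e: "1 - e = \<kappa>" "\<alpha> + e * \<beta> = \<kappa>" using \<alpha>\<beta> by (auto simp: e_def \<kappa>_def field_simps)
  have eq1: "2 * (M * h) / (h powr e) = 2 * M * h powr \<kappa>"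
    unfolding e(1)[symmetric] using h by (simp add: powr_diff)
  have eq2: "C * h powr \<alpha> * (h powr e) powr \<beta> = C * h powr \<kappa>"
    unfolding e(2)[symmetric] using h by (simp add: powr_powr powr_add)
  have bound: "norm (DA t x - DA s x) \<le> 2 * D * h powr \<kappa>" for x
  proof -
    have "norm (DA t x - DA s x) \<le> 2 * (M * h) / (h powr e) + C * h powr \<alpha> * (h powr e) powr \<beta>"
    proof (rule derivative_bound_interpolation[where F = "incr s t" and DF = "\<lambda>x. DA t x - DA s x"])
      show "norm (incr s t x - incr s t y) \<le> 2 * (M * h)" for x y
        using norm_triangle_ineq4[of "incr s t x" "incr s t y"] incr_bound[OF st, of x] incr_bound[OF st, of y]
        by (simp add: h_def)
      show "(incr s t has_derivative blinfun_apply (DA t x - DA s x)) (at x)" for x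
        by (rule incr_derivative[OF st])
      show "norm (DA t x - DA s x - (DA t y - DA s y)) \<le> C * h powr \<alpha> * norm (x - y) powr \<beta>" for x y
        using DA_holder[OF st] by (simp add: h_def)
    qed (use \<alpha>\<beta> C h in auto)
    also have "\<dots> \<le> 2 * D * h powr \<kappa>"
      unfolding eq1 eq2 using C by (simp add: D_def distrib_right)
    finally show ?thesis .
  qed
  show ?thesis
  proof (rule differentiable_bound[where S = UNIV])
    show "(incr s t has_derivative blinfun_apply (DA t x - DA s x)) (at x within UNIV)" for x
      using incr_derivative[OF st] by simp
    show "onorm (blinfun_apply (DA t x - DA s x)) \<le> 2 * D * (t - s) powr \<kappa>" for x
      using bound[of x] by (simp add: norm_blinfun.rep_eq h_def)
  qed auto
qed

lemma lip_continuous: "lip x \<Longrightarrow> continuous_on {0..T} x"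
proof -
  assume x: "lip x"
  have "M-lipschitz_on {0..T} x"
  proof (rule lipschitz_onI)
    fix s t assume "s \<in> {0..T}" "t \<in> {0..T}"
    then show "dist (x s) (x t) \<le> M * dist s t"
      using x unfolding lip_def dist_norm
      by (cases "s \<le> t") (auto simp: norm_minus_commute)
  qed (use M in simp)
  then show ?thesis by (rule lipschitz_on_continuous_on)
qed

section \<open>Primitives along continuous paths and Young integrals\<close>

text \<open>Take \<open>x0\<close> plus the Riemann integral of \<open>dA r (z r)\<close>. The bound
  on \<open>dA\<close> makes it Lipschitz, and freezing \<open>z\<close> at the left end of a short
  interval changes the integrand by little.\<close>

lemma primitive_exists:
  assumes z: "continuous_on {0..T} z"
  shows "\<exists>x. germ z x \<and> lip x \<and> x 0 = x0"
proof -
  define x where "x t = x0 + integral {0..t} (\<lambda>r. dA r (z r))" for t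
  have cont: "continuous_on {s..t} (\<lambda>r. dA r (z r))" if "0 \<le> s" "t \<le> T" for s t
    by (rule continuous_on_dA) (use that in \<open>auto intro!: continuous_intros continuous_on_subset[OF z]\<close>)
  have cont': "continuous_on {s..t} (\<lambda>r. dA r y)" if "0 \<le> s" "t \<le> T" for s t y
    by (rule continuous_on_dA) (use that in \<open>auto intro!: continuous_intros\<close>)
  have x: "x t - x s = integral {s..t} (\<lambda>r. dA r (z r))" if "0 \<le> s" "s \<le> t" "t \<le> T" for s t
    using Henstock_Kurzweil_Integration.integral_combine[OF that(1,2) integrable_continuous_real[OF cont[OF order_refl that(3)]]]
    by (simp add: x_def algebra_simps)
  have "lip x"
    unfolding lip_def
  proof (intro allI impI)
    fix s t assume st: "0 \<le> s" "s \<le> t" "t \<le> T"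
    show "norm (x t - x s) \<le> M * (t - s)"
      unfolding x[OF st] by (rule integral_bound) (use st cont dA_bound in auto)
  qed
  moreover have "germ z x"
    unfolding germ_def
  proof (intro allI impI)
    fix \<epsilon> :: real assume \<epsilon>: "\<epsilon> > 0"
    \<comment> \<open>Continuity of \<open>dA\<close> on the non-compact space is not uniform in
      general; composing with \<open>z\<close> moves the question to the compact square of times
      \<open>(r, s)\<close>.\<close>
    have "continuous_on ({0..T} \<times> {0..T}) (\<lambda>p. dA (fst p) (z (snd p)))"
      by (rule continuous_on_dA) (auto intro!: continuous_intros continuous_on_compose2[OF z])
    then have "uniformly_continuous_on ({0..T} \<times> {0..T}) (\<lambda>p. dA (fst p) (z (snd p)))"
      by (rule compact_uniformly_continuous) (intro compact_Times compact_Icc)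
    then obtain \<delta> where \<delta>: "\<delta> > 0"
      "\<And>p q. p \<in> {0..T} \<times> {0..T} \<Longrightarrow> q \<in> {0..T} \<times> {0..T} \<Longrightarrow> dist q p < \<delta> \<Longrightarrow>
        dist (dA (fst q) (z (snd q))) (dA (fst p) (z (snd p))) < \<epsilon>"
      unfolding uniformly_continuous_on_def using \<epsilon> by metis
    have "norm (x t - x s - incr s t (z s)) \<le> \<epsilon> * (t - s)"
      if st: "0 \<le> s" "s \<le> t" "t \<le> T" and h: "t - s < \<delta>" for s t
    proof -
      have "x t - x s - incr s t (z s) = integral {s..t} (\<lambda>r. dA r (z r) - dA r (z s))"
        unfolding x[OF st] integral_unique[OF dA_integral[OF st], symmetric]
        by (rule integral_diff[symmetric]) (use st in \<open>auto intro!: integrable_continuous_real cont cont'\<close>)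
      also have "norm \<dots> \<le> \<epsilon> * (t - s)"
      proof (rule integral_bound)
        fix r assume "r \<in> {s..t}"
        then show "norm (dA r (z r) - dA r (z s)) \<le> \<epsilon>"
          using \<delta>(2)[of "(r, s)" "(r, r)"] st h
          by (auto simp: dist_Pair_Pair dist_norm less_imp_le)
      qed (use st in \<open>auto intro!: continuous_on_diff cont cont'\<close>)
      finally show ?thesis .
    qed
    with \<delta>(1) show "\<exists>\<delta>>0. \<forall>s t. 0 \<le> s \<longrightarrow> s \<le> t \<longrightarrow> t \<le> T \<longrightarrow> t - s < \<delta> \<longrightarrow>
        norm (x t - x s - incr s t (z s)) \<le> \<epsilon> * (t - s)"
      by blast
  qed
  ultimately show ?thesis by (auto simp: x_def)
qed

text \<open>Increments of \<open>x\<close> telescope, so the error of a Riemann sum is the sum of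
  the local errors, each bounded by a small multiple of the length of its interval.\<close>

lemma germ_young_integral:
  assumes g: "germ z x" and t: "0 \<le> t" "t \<le> T"
  shows "young_integral_is A z 0 t (x t - x 0)"
  unfolding young_integral_is_def
proof (intro allI impI)
  fix \<epsilon> :: real assume \<epsilon>: "\<epsilon> > 0"
  \<comment> \<open>Dividing by \<open>t + 1\<close> covers \<open>t = 0\<close> and makes the final
    inequality strict.\<close>
  have "\<epsilon> / (t + 1) > 0" using \<epsilon> t by simp
  then obtain \<delta> where \<delta>: "\<delta> > 0"
    "\<And>s u. 0 \<le> s \<Longrightarrow> s \<le> u \<Longrightarrow> u \<le> T \<Longrightarrow> u - s < \<delta> \<Longrightarrow>
      norm (x u - x s - incr s u (z s)) \<le> \<epsilon> / (t + 1) * (u - s)"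
    using g unfolding germ_def by metis
  have "norm (riemann_sum A z ps - (x t - x 0)) < \<epsilon>"
    if ps: "is_partition 0 t ps" and mesh: "mesh_less ps \<delta>" for ps
  proof -
    define n where "n = length ps - 1"
    have len: "length ps = Suc n" using ps by (cases ps) (auto simp: n_def is_partition_def)
    have ends: "ps ! 0 = 0" "ps ! n = t"
      using ps len by (auto simp: is_partition_def hd_conv_nth last_conv_nth)
    have mono: "ps ! i \<le> ps ! j" if "i \<le> j" "j \<le> n" for i j
      using ps that len unfolding is_partition_def
      by (cases "i = j") (auto simp: sorted_wrt_iff_nth_less less_imp_le)
    have telescope: "(\<Sum>i<n. f (ps ! Suc i) - f (ps ! i)) = f t - f 0" for f :: "real \<Rightarrow> 'b::ab_group_add"
      using sum_lessThan_telescope[of "\<lambda>i. f (ps ! i)" n] ends by simp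
    have "riemann_sum A z ps - (x t - x 0) =
        - (\<Sum>i<n. x (ps ! Suc i) - x (ps ! i) - incr (ps ! i) (ps ! Suc i) (z (ps ! i)))"
      unfolding telescope[symmetric] riemann_sum_def n_def[symmetric] incr_def sum_subtractf[symmetric]
      by (subst sum_negf[symmetric]) simp
    also have "norm \<dots> \<le> (\<Sum>i<n. \<epsilon> / (t + 1) * (ps ! Suc i - ps ! i))"
      unfolding norm_minus_cancel
    proof (rule sum_norm_le, rule \<delta>(2))
      fix i assume "i \<in> {..<n}"
      then have i: "Suc i \<le> n" by simp
      show "0 \<le> ps ! i" using mono[of 0 i] i ends by simp
      show "ps ! i \<le> ps ! Suc i" using mono[of i "Suc i"] i by simp
      show "ps ! Suc i \<le> T" using mono[of "Suc i" n] i ends t by simp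
      show "ps ! Suc i - ps ! i < \<delta>" using mesh i len by (simp add: mesh_less_def)
    qed
    also have "\<dots> = \<epsilon> / (t + 1) * t"
      unfolding sum_distrib_left[symmetric] using telescope[of "\<lambda>r. r"] by simp
    also have "\<dots> < \<epsilon>" using \<epsilon> t by (simp add: field_simps)
    finally show ?thesis .
  qed
  with \<delta>(1) show "\<exists>\<delta>>0. \<forall>ps. is_partition 0 t ps \<and> mesh_less ps \<delta> \<longrightarrow>
      norm (riemann_sum A z ps - (x t - x 0)) < \<epsilon>"
    by blast
qed

subsection \<open>Sewing estimates\<close>

text \<open>Sewing with exponent \<open>1 + \<kappa>\<close>: the midpoint defect
  \<open>incr m t (z m) - incr m t (z s)\<close> is at most
  \<open>2 * D * h powr \<kappa> * (M * h)\<close> with \<open>h = t - s\<close>. Unlike the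
  \<open>\<delta>\<close> in \<open>germ\<close>, the resulting rate is the same for all paths, so
  it survives limits of Picard iterates.\<close>

lemma germ_estimate:
  assumes g: "germ z x" and z: "lip z" and st: "0 \<le> s" "s \<le> t" "t \<le> T"
  shows "norm (x t - x s - incr s t (z s)) \<le>
    2 * D * M / (1 - 2 powr (1 - (1 + \<kappa>))) * (t - s) powr (1 + \<kappa>)"
proof (rule dyadic_sewing[where a = 0 and b = T and R = "\<lambda>s t. norm (x t - x s - incr s t (z s))"])
  fix s t assume st: "0 \<le> s" "s \<le> t" "t \<le> T"
  define m where "m = (s + t) / 2"
  have m: "s \<le> m" "m \<le> t" "0 \<le> m" "m \<le> T" using st by (auto simp: m_def)
  have "norm (incr m t (z m) - incr m t (z s)) \<le> 2 * D * (t - m) powr \<kappa> * norm (z m - z s)"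
    by (rule incr_lipschitz) (use m st in auto)
  also have "\<dots> \<le> 2 * D * (t - s) powr \<kappa> * (M * (t - s))"
  proof (intro mult_mono powr_mono2)
    have "norm (z m - z s) \<le> M * (m - s)" using z m st unfolding lip_def by blast
    also have "\<dots> \<le> M * (t - s)" using m M by simp
    finally show "norm (z m - z s) \<le> M * (t - s)" .
  qed (use m \<kappa> D in auto)
  also have "\<dots> = 2 * D * M * (t - s) powr (1 + \<kappa>)"
    using st by (cases "s = t") (auto simp: powr_add)
  finally have "norm (incr m t (z m) - incr m t (z s)) \<le> 2 * D * M * (t - s) powr (1 + \<kappa>)" .
  moreover have "x t - x s - incr s t (z s) =
      ((x m - x s - incr s m (z s)) + (x t - x m - incr m t (z m))) + (incr m t (z m) - incr m t (z s))"
    by (simp add: incr_def)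
  ultimately show "norm (x t - x s - incr s t (z s)) \<le>
      norm (x ((s + t) / 2) - x s - incr s ((s + t) / 2) (z s)) +
      norm (x t - x ((s + t) / 2) - incr ((s + t) / 2) t (z ((s + t) / 2))) +
      2 * D * M * (t - s) powr (1 + \<kappa>)"
    unfolding m_def[symmetric] by (metis add_mono norm_triangle_mono order_refl)
qed (use g st D M \<kappa> in \<open>auto simp: germ_def\<close>)

text \<open>Sewing for \<open>x - x'\<close> against the difference of the two increments of the
  field. By \<open>four_point_estimate\<close> the midpoint defect is at most a multiple of
  \<open>N * h powr (2 * \<kappa>)\<close> plus a multiple of
  \<open>S * h powr (\<alpha> + \<beta>)\<close>, where \<open>h = t - s\<close>, and both exponents
  exceed 1. The term in \<open>S\<close> alone is the increment difference at the left end.\<close>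

lemma difference_estimate:
  assumes g: "germ z x" "germ z' x'" and z: "lip z" "lip z'"
    and ab: "0 \<le> a" "b \<le> T" "b - a \<le> 1"
    and N: "\<And>s u. a \<le> s \<Longrightarrow> s \<le> u \<Longrightarrow> u \<le> b \<Longrightarrow>
      norm ((z u - z' u) - (z s - z' s)) \<le> N * (u - s) powr \<kappa>" "N \<ge> 0"
    and S: "\<And>s. a \<le> s \<Longrightarrow> s \<le> b \<Longrightarrow> norm (z s - z' s) \<le> S" "S \<ge> 0"
    and st: "a \<le> s" "s \<le> t" "t \<le> b"
  shows "norm ((x t - x' t) - (x s - x' s)) \<le> 2 * D * S * (t - s) powr \<kappa> +
    (2 * D * N + C * M powr \<beta> * S) / (1 - 2 powr (1 - (\<alpha> + \<beta>))) * (t - s) powr (\<alpha> + \<beta>)"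
proof -
  define \<Xi> where "\<Xi> s t = incr s t (z s) - incr s t (z' s)" for s t
  define w where "w t = x t - x' t" for t
  have "norm (w t - w s - \<Xi> s t) \<le>
      (2 * D * N + C * M powr \<beta> * S) / (1 - 2 powr (1 - (\<alpha> + \<beta>))) * (t - s) powr (\<alpha> + \<beta>)"
  proof (rule dyadic_sewing[where a = a and b = b and R = "\<lambda>s t. norm (w t - w s - \<Xi> s t)"])
    fix s t assume st: "a \<le> s" "s \<le> t" "t \<le> b"
    define m where "m = (s + t) / 2"
    have m: "s \<le> m" "m \<le> t" "a \<le> m" "m \<le> b" "0 \<le> m" "t \<le> T"
      using st ab by (auto simp: m_def)
    define h where "h = t - s"
    have h: "0 \<le> h" "h \<le> 1" using st ab by (auto simp: h_def)
    have N': "norm ((z m - z' m) - (z s - z' s)) \<le> N * h powr \<kappa>"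
    proof -
      have "norm ((z m - z' m) - (z s - z' s)) \<le> N * (m - s) powr \<kappa>"
        by (rule N) (use m st in auto)
      also have "\<dots> \<le> N * h powr \<kappa>"
        unfolding h_def using N(2) m \<kappa> by (intro mult_left_mono powr_mono2) auto
      finally show ?thesis .
    qed
    have z'_lip: "norm (z' m - z' s) \<le> M * h"
    proof -
      have "norm (z' m - z' s) \<le> M * (m - s)" using z(2) m st ab unfolding lip_def by auto
      also have "\<dots> \<le> M * h" unfolding h_def using m M by simp
      finally show ?thesis .
    qed
    have "norm ((incr m t (z m) - incr m t (z' m)) - (incr m t (z s) - incr m t (z' s)))
        \<le> 2 * D * (t - m) powr \<kappa> * norm ((z m - z' m) - (z s - z' s)) +
          C * (t - m) powr \<alpha> * norm (z' m - z' s) powr \<beta> * norm (z s - z' s)"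
      by (rule four_point_estimate[where DF = "\<lambda>x. DA t x - DA m x"])
        (use m in \<open>auto intro!: incr_derivative incr_lipschitz DA_holder\<close>)
    also have "\<dots> \<le> 2 * D * h powr \<kappa> * (N * h powr \<kappa>) + C * h powr \<alpha> * (M * h) powr \<beta> * S"
    proof (rule add_mono)
      have "(t - m) powr \<kappa> \<le> h powr \<kappa>" "(t - m) powr \<alpha> \<le> h powr \<alpha>"
        using m \<kappa> \<alpha>\<beta> by (auto simp: h_def intro!: powr_mono2)
      then show "2 * D * (t - m) powr \<kappa> * norm ((z m - z' m) - (z s - z' s)) \<le> 2 * D * h powr \<kappa> * (N * h powr \<kappa>)"
        using N' D by (intro mult_mono) auto
      have "norm (z' m - z' s) powr \<beta> \<le> (M * h) powr \<beta>"
        using z'_lip \<alpha>\<beta> by (intro powr_mono2) auto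
      moreover have "norm (z s - z' s) \<le> S" using S(1)[of s] st by simp
      moreover have "C * (t - m) powr \<alpha> \<le> C * h powr \<alpha>"
        using \<open>(t - m) powr \<alpha> \<le> h powr \<alpha>\<close> C by (rule mult_left_mono)
      ultimately show "C * (t - m) powr \<alpha> * norm (z' m - z' s) powr \<beta> * norm (z s - z' s) \<le>
          C * h powr \<alpha> * (M * h) powr \<beta> * S"
        using C S(2) by (intro mult_mono[OF mult_mono]) auto
    qed
    also have "2 * D * h powr \<kappa> * (N * h powr \<kappa>) = 2 * D * N * h powr (2 * \<kappa>)"
      using powr_add[of h \<kappa> \<kappa>] by simp
    also have "C * h powr \<alpha> * (M * h) powr \<beta> * S = C * M powr \<beta> * S * h powr (\<alpha> + \<beta>)"
      using M h by (simp add: powr_mult powr_add)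
    \<comment> \<open>Since \<open>h \<le> 1\<close>, lowering the exponent enlarges the power, and
      one sewing exponent serves both terms.\<close>
    also have "2 * D * N * h powr (2 * \<kappa>) \<le> 2 * D * N * h powr (\<alpha> + \<beta>)"
      using \<kappa> h D N(2) by (intro mult_left_mono powr_mono') auto
    finally have "norm ((incr m t (z m) - incr m t (z' m)) - (incr m t (z s) - incr m t (z' s)))
        \<le> (2 * D * N + C * M powr \<beta> * S) * h powr (\<alpha> + \<beta>)"
      by (simp add: distrib_right)
    moreover have "w t - w s - \<Xi> s t = ((w m - w s - \<Xi> s m) + (w t - w m - \<Xi> m t)) +
        ((incr m t (z m) - incr m t (z' m)) - (incr m t (z s) - incr m t (z' s)))"
      by (simp add: incr_def \<Xi>_def)
    ultimately show "norm (w t - w s - \<Xi> s t) \<le>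
        norm (w ((s + t) / 2) - w s - \<Xi> s ((s + t) / 2)) +
        norm (w t - w ((s + t) / 2) - \<Xi> ((s + t) / 2) t) +
        (2 * D * N + C * M powr \<beta> * S) * (t - s) powr (\<alpha> + \<beta>)"
      unfolding m_def[symmetric] h_def by (metis add_mono norm_triangle_mono order_refl)
  next
    fix \<epsilon> :: real assume "\<epsilon> > 0"
    then have e: "\<epsilon> / 2 > 0" by simp
    obtain \<delta>1 where 1: "\<delta>1 > 0" "\<And>s t. 0 \<le> s \<Longrightarrow> s \<le> t \<Longrightarrow> t \<le> T \<Longrightarrow> t - s < \<delta>1 \<Longrightarrow>
        norm (x t - x s - incr s t (z s)) \<le> \<epsilon> / 2 * (t - s)"
      using g(1) e unfolding germ_def by metis
    obtain \<delta>2 where 2: "\<delta>2 > 0" "\<And>s t. 0 \<le> s \<Longrightarrow> s \<le> t \<Longrightarrow> t \<le> T \<Longrightarrow> t - s < \<delta>2 \<Longrightarrow>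
        norm (x' t - x' s - incr s t (z' s)) \<le> \<epsilon> / 2 * (t - s)"
      using g(2) e unfolding germ_def by metis
    have "norm (w t - w s - \<Xi> s t) \<le> \<epsilon> * (t - s)"
      if "a \<le> s" "s \<le> t" "t \<le> b" "t - s < min \<delta>1 \<delta>2" for s t
    proof -
      have "w t - w s - \<Xi> s t = (x t - x s - incr s t (z s)) - (x' t - x' s - incr s t (z' s))"
        by (simp add: w_def \<Xi>_def)
      also have "norm \<dots> \<le> \<epsilon> / 2 * (t - s) + \<epsilon> / 2 * (t - s)"
        by (rule order_trans[OF norm_triangle_ineq4 add_mono[OF 1(2) 2(2)]]) (use that ab in auto)
      finally show ?thesis by simp
    qed
    then show "\<exists>\<delta>>0. \<forall>s t. a \<le> s \<longrightarrow> s \<le> t \<longrightarrow> t \<le> b \<longrightarrow> t - s < \<delta> \<longrightarrow>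
        norm (w t - w s - \<Xi> s t) \<le> \<epsilon> * (t - s)"
      using 1(1) 2(1) by (intro exI[of _ "min \<delta>1 \<delta>2"]) auto
  qed (use st \<alpha>\<beta> D C N S in auto)
  moreover have "norm (\<Xi> s t) \<le> 2 * D * S * (t - s) powr \<kappa>"
  proof -
    have "norm (\<Xi> s t) \<le> 2 * D * (t - s) powr \<kappa> * norm (z s - z' s)"
      unfolding \<Xi>_def by (rule incr_lipschitz) (use st ab in auto)
    also have "\<dots> \<le> 2 * D * (t - s) powr \<kappa> * S"
      using S(1)[of s] st D by (intro mult_left_mono) auto
    finally show ?thesis by (simp add: mult_ac)
  qed
  moreover have "norm (w t - w s) \<le> norm (\<Xi> s t) + norm (w t - w s - \<Xi> s t)"
    by (metis norm_triangle_sub add.commute)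
  ultimately show ?thesis unfolding w_def by linarith
qed

text \<open>The total constant of \<open>difference_estimate\<close> once \<open>S\<close> and
  \<open>N * \<tau> powr (\<kappa> * \<beta>)\<close> are both bounded by the single quantity
  \<open>E + N * \<tau> powr (\<kappa> * \<beta>)\<close>.\<close>

definition P where "P = 2 * D + (2 * D + C * M powr \<beta>) / (1 - 2 powr (1 - (\<alpha> + \<beta>)))"

lemma P_summand: "(2 * D + C * M powr \<beta>) / (1 - 2 powr (1 - (\<alpha> + \<beta>))) \<ge> 0"
  using D C \<alpha>\<beta> by (intro divide_nonneg_nonneg) (auto simp: powr_less_one less_imp_le)

lemma P: "P > 0"
  using P_summand D by (simp add: P_def)

text \<open>In the sewing term \<open>(t - s) powr (\<alpha> + \<beta>)\<close> releases a factor
  \<open>\<tau> powr (\<kappa> * \<beta>)\<close>, and the sup of \<open>z - z'\<close> is at most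
  \<open>E + N * \<tau> powr \<kappa>\<close>. Thus \<open>N\<close> enters only with a factor that
  is small for short intervals.\<close>

lemma local_contraction:
  assumes g: "germ z x" "germ z' x'" and z: "lip z" "lip z'"
    and ab: "0 \<le> a" "b \<le> T" "b - a \<le> \<tau>" "\<tau> \<le> 1"
    and N: "\<And>s u. a \<le> s \<Longrightarrow> s \<le> u \<Longrightarrow> u \<le> b \<Longrightarrow>
      norm ((z u - z' u) - (z s - z' s)) \<le> N * (u - s) powr \<kappa>" "N \<ge> 0"
    and E: "norm (z a - z' a) \<le> E"
    and st: "a \<le> s" "s \<le> t" "t \<le> b"
  shows "norm ((x t - x' t) - (x s - x' s)) \<le> P * (E + N * \<tau> powr (\<kappa> * \<beta>)) * (t - s) powr \<kappa>"
proof -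
  define q where "q = \<tau> powr (\<kappa> * \<beta>)"
  define S where "S = E + N * q"
  define c where "c = 1 / (1 - 2 powr (1 - (\<alpha> + \<beta>)))"
  have c: "c \<ge> 0" using \<alpha>\<beta> by (auto simp: c_def powr_less_one less_imp_le)
  have E0: "E \<ge> 0" using E norm_ge_zero order_trans by blast
  have q: "q \<ge> 0" by (simp add: q_def)
  have \<tau>: "0 \<le> \<tau>" using ab st by linarith
  have h: "0 \<le> t - s" "t - s \<le> \<tau>" using st ab by auto
  have S0: "S \<ge> 0" using E0 N q by (simp add: S_def)
  have bound: "norm (z r - z' r) \<le> S" if "a \<le> r" "r \<le> b" for r
  proof -
    have "norm (z r - z' r) \<le> norm (z a - z' a) + norm ((z r - z' r) - (z a - z' a))"
      by (metis norm_triangle_sub add.commute)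
    also have "\<dots> \<le> E + N * (r - a) powr \<kappa>"
      using N(1)[of a r] E that by (intro add_mono) auto
    also have "(r - a) powr \<kappa> \<le> \<tau> powr \<kappa>"
      using that ab \<kappa> by (intro powr_mono2) auto
    \<comment> \<open>As \<open>\<tau> \<le> 1\<close> and \<beta> < 1, the weaker power
      \<open>\<kappa> * \<beta>\<close> bounds this one too.\<close>
    also have "\<tau> powr \<kappa> \<le> q"
      unfolding q_def using \<tau> ab \<kappa> \<alpha>\<beta> by (intro powr_mono') auto
    finally show ?thesis using N(2) by (simp add: S_def mult_left_mono)
  qed
  have "norm ((x t - x' t) - (x s - x' s)) \<le> 2 * D * S * (t - s) powr \<kappa> +
      (2 * D * N + C * M powr \<beta> * S) / (1 - 2 powr (1 - (\<alpha> + \<beta>))) * (t - s) powr (\<alpha> + \<beta>)"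
    by (rule difference_estimate[OF g z ab(1,2) _ N bound S0 st]) (use ab in auto)
  also have "\<dots> = 2 * D * S * (t - s) powr \<kappa> +
      c * (2 * D * N + C * M powr \<beta> * S) * ((t - s) powr (\<kappa> * \<beta>) * (t - s) powr \<kappa>)"
    using \<kappa>(3) powr_add[of "t - s" "\<kappa> * \<beta>" \<kappa>] by (simp add: c_def algebra_simps add_divide_distrib)
  also have "\<dots> \<le> 2 * D * S * (t - s) powr \<kappa> +
      c * (2 * D * N + C * M powr \<beta> * S) * (q * (t - s) powr \<kappa>)"
    using c D N(2) C S0 h \<kappa> \<alpha>\<beta> unfolding q_def
    by (intro add_left_mono mult_left_mono mult_right_mono powr_mono2) auto
  also have "\<dots> = (2 * D * S + c * (2 * D * (N * q) + C * M powr \<beta> * (S * q))) * (t - s) powr \<kappa>"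
    by (simp add: algebra_simps)
  also have "\<dots> \<le> (2 * D * S + c * (2 * D * S + C * M powr \<beta> * S)) * (t - s) powr \<kappa>"
  proof -
    have "N * q \<le> S" using E0 by (simp add: S_def)
    moreover have "q \<le> 1"
      unfolding q_def using \<tau> ab \<kappa> \<alpha>\<beta> by (intro powr_le1) auto
    then have "S * q \<le> S" using S0 by (simp add: mult_left_le)
    ultimately show ?thesis
      using c D C by (intro mult_right_mono add_mono mult_left_mono) auto
  qed
  also have "\<dots> = P * S * (t - s) powr \<kappa>"
    by (simp add: P_def c_def algebra_simps add_divide_distrib)
  finally show ?thesis by (simp add: S_def q_def)
qed

subsection \<open>Picard iteration\<close>

text \<open>The second entry makes \<open>P * \<tau> powr (\<kappa> * \<beta>)\<close> equal to 1/2;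
  the minimum keeps cells no longer than 1.\<close>

definition \<tau> where "\<tau> = min 1 ((1 / (2 * P)) powr (1 / (\<kappa> * \<beta>)))"

text \<open>Chosen to give \<open>P / (L - 1) = 1 / 4\<close>.\<close>

definition L where "L = 1 + 4 * P"

lemma \<tau>: "0 < \<tau>" "\<tau> \<le> 1" "P * \<tau> powr (\<kappa> * \<beta>) \<le> 1 / 2"
proof -
  show "0 < \<tau>" "\<tau> \<le> 1" using P by (auto simp: \<tau>_def)
  then have "\<tau> powr (\<kappa> * \<beta>) \<le> ((1 / (2 * P)) powr (1 / (\<kappa> * \<beta>))) powr (\<kappa> * \<beta>)"
    using \<kappa> \<alpha>\<beta> by (intro powr_mono2) (auto simp: \<tau>_def)
  also have "\<dots> = 1 / (2 * P)" using P \<kappa> \<alpha>\<beta> by (simp add: powr_powr)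
  finally show "P * \<tau> powr (\<kappa> * \<beta>) \<le> 1 / 2" using P by (simp add: field_simps)
qed

lemma L: "L > 1" using P by (simp add: L_def)

text \<open>The factor is 3/4 = 1/4 + 1/2: the discrepancy at the start of a cell contributes 1/4
  through the growth of the weights, and the Hoelder seminorm on the cell contributes 1/2 through
  the choice of \<open>\<tau>\<close>.\<close>

lemma contraction:
  assumes g: "germ z x" "germ z' x'" and z: "lip z" "lip z'" "z 0 = z' 0"
    and B: "B \<ge> 0" and H: "weighted_holder T \<kappa> \<tau> L B (\<lambda>t. z t - z' t)"
  shows "weighted_holder T \<kappa> \<tau> L (3 / 4 * B) (\<lambda>t. x t - x' t)"
  unfolding weighted_holder_def
proof (intro allI impI)
  fix j s u
  assume su: "real j * \<tau> \<le> s" "s \<le> u" "u \<le> (real j + 1) * \<tau>" "u \<le> T"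
  let ?E = "B * L ^ j / (L - 1)" and ?N = "B * L ^ j"
  have E: "norm (z (real j * \<tau>) - z' (real j * \<tau>)) \<le> ?E"
    using weighted_holder_grid_bound[OF H _ \<tau>(1,2) \<kappa>(1) L B, of j] z(3) su by simp
  have "norm ((x u - x' u) - (x s - x' s)) \<le> P * (?E + ?N * \<tau> powr (\<kappa> * \<beta>)) * (u - s) powr \<kappa>"
  \<comment> \<open>The interval ends at \<open>u\<close> because the last cell may reach beyond
    \<open>T\<close>.\<close>
  proof (rule local_contraction[OF g z(1,2), where a = "real j * \<tau>" and b = u and \<tau> = \<tau>])
    fix r v assume "real j * \<tau> \<le> r" "r \<le> v" "v \<le> u"
    then show "norm ((z v - z' v) - (z r - z' r)) \<le> ?N * (v - r) powr \<kappa>"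
      using H[unfolded weighted_holder_def, rule_format, of j r v] su by auto
  qed (use su \<tau> B L E in \<open>auto simp: algebra_simps\<close>)
  also have "\<dots> \<le> 3 / 4 * B * L ^ j * (u - s) powr \<kappa>"
  proof (rule mult_right_mono)
    have "P * ?E = ?N / 4" using P by (simp add: L_def)
    moreover have "?N * (P * \<tau> powr (\<kappa> * \<beta>)) \<le> ?N * (1 / 2)"
      using \<tau>(3) B L by (intro mult_left_mono) auto
    ultimately show "P * (?E + ?N * \<tau> powr (\<kappa> * \<beta>)) \<le> 3 / 4 * B * L ^ j"
      by (simp add: algebra_simps)
  qed simp
  finally show "norm (x u - x' u - (x s - x' s)) \<le> 3 / 4 * B * L ^ j * (u - s) powr \<kappa>" .
qed

text \<open>This starts the iteration: on a cell of length at most 1 a Lipschitz bound implies a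
  \<open>\<kappa>\<close>-Hoelder bound, and the weights \<open>L ^ j\<close> are at least
  1.\<close>

lemma lip_difference:
  assumes "lip x" "lip y"
  shows "weighted_holder T \<kappa> \<tau> L (2 * M) (\<lambda>t. x t - y t)"
  unfolding weighted_holder_def
proof (intro allI impI)
  fix j s u
  assume su: "real j * \<tau> \<le> s" "s \<le> u" "u \<le> (real j + 1) * \<tau>" "u \<le> T"
  have s0: "0 \<le> s" using su(1) \<tau>(1) by (meson mult_nonneg_nonneg of_nat_0_le_iff less_imp_le order_trans)
  have h: "0 \<le> u - s" "u - s \<le> 1" using su \<tau> by (auto simp: algebra_simps)
  have "(x u - y u) - (x s - y s) = (x u - x s) - (y u - y s)" by simp
  also have "norm \<dots> \<le> M * (u - s) + M * (u - s)"
    using assms su s0 unfolding lip_def by (intro order_trans[OF norm_triangle_ineq4 add_mono]) auto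
  also have "\<dots> = 2 * M * (u - s) powr 1" using h by simp
  also have "\<dots> \<le> 2 * M * (u - s) powr \<kappa>"
    using h \<kappa> M by (intro mult_left_mono powr_mono') auto
  also have "\<dots> \<le> 2 * M * L ^ j * (u - s) powr \<kappa>"
    using M L by (intro mult_right_mono) auto
  finally show "norm (x u - y u - (x s - y s)) \<le> 2 * M * L ^ j * (u - s) powr \<kappa>" .
qed

section \<open>Uniqueness and existence of fixed points\<close>

text \<open>Both paths are primitives along themselves, so \<open>contraction\<close> applies to
  their difference again and again and drives its weighted seminorm to 0.\<close>

lemma germ_unique:
  assumes x: "germ x x" "lip x" and y: "germ y y" "lip y" and eq: "x 0 = y 0" and t: "t \<in> {0..T}"
  shows "x t = y t"
proof -
  have H: "weighted_holder T \<kappa> \<tau> L (2 * M * (3 / 4) ^ n) (\<lambda>t. x t - y t)" for n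
  proof (induction n)
    case 0
    then show ?case using lip_difference[OF x(2) y(2)] by simp
  next
    case (Suc n)
    then show ?case
      using contraction[OF x(1) y(1) x(2) y(2) eq _ Suc] M by (simp add: mult_ac)
  qed
  obtain G where G: "\<And>B v. B \<ge> 0 \<Longrightarrow> weighted_holder T \<kappa> \<tau> L B v \<Longrightarrow> v 0 = (0::'v) \<Longrightarrow>
      (\<forall>s\<in>{0..T}. norm (v s) \<le> B * G)"
    using weighted_holder_bound[OF \<tau>(1,2) \<kappa>(1) L T] by blast
  have "norm (x t - y t) \<le> 2 * M * (3 / 4) ^ n * G" for n
    using G[OF _ H[of n]] eq M t by simp
  moreover have "(\<lambda>n. 2 * M * (3 / 4) ^ n * G) \<longlonglongrightarrow> 2 * M * 0 * G"
    by (intro tendsto_intros LIMSEQ_power_zero) simp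
  ultimately have "norm (x t - y t) \<le> 2 * M * 0 * G"
    by (intro LIMSEQ_le_const) auto
  then show ?thesis by simp
qed

lemma germ_exists: "\<exists>x. germ x x \<and> lip x \<and> x 0 = x0"
proof -
  \<comment> \<open>The Picard map; a choice operator is used since primitives are given by an
    existence statement. Iteration starts from the constant path \<open>x0\<close>.\<close>
  define \<Phi> where "\<Phi> z = (SOME x. germ z x \<and> lip x \<and> x 0 = x0)" for z
  have \<Phi>: "germ z (\<Phi> z)" "lip (\<Phi> z)" "\<Phi> z 0 = x0" if "lip z" for z
    using someI_ex[OF primitive_exists[OF lip_continuous[OF that], of x0]] by (simp_all add: \<Phi>_def)
  define X where "X n = (\<Phi> ^^ n) (\<lambda>_. x0)" for n
  have X: "lip (X n)" "X n 0 = x0" for n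
  proof (induction n)
    case 0
    { case 1 show ?case using M by (simp add: X_def lip_def) }
    { case 2 show ?case by (simp add: X_def) }
  next
    case (Suc n)
    { case 1 show ?case using \<Phi>(2) Suc by (simp add: X_def) }
    { case 2 show ?case using \<Phi>(3) Suc by (simp add: X_def) }
  qed
  have germ_X: "germ (X n) (X (Suc n))" for n
    using \<Phi>(1)[OF X(1)] by (simp add: X_def)
  have H: "weighted_holder T \<kappa> \<tau> L (2 * M * (3 / 4) ^ n) (\<lambda>t. X (Suc n) t - X n t)" for n
  proof (induction n)
    case 0
    then show ?case using lip_difference[OF X(1) X(1)] by simp
  next
    case (Suc n)
    show ?case
      using contraction[OF germ_X germ_X X(1) X(1) _ _ Suc] M X(2) by (simp add: mult_ac)
  qed
  obtain G where G: "\<And>B v. B \<ge> 0 \<Longrightarrow> weighted_holder T \<kappa> \<tau> L B v \<Longrightarrow> v 0 = (0::'v) \<Longrightarrow>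
      (\<forall>s\<in>{0..T}. norm (v s) \<le> B * G)"
    using weighted_holder_bound[OF \<tau>(1,2) \<kappa>(1) L T] by blast
  define x where "x t = lim (\<lambda>n. X n t)" for t
  have lim: "(\<lambda>n. X n t) \<longlonglongrightarrow> x t" if t: "t \<in> {0..T}" for t
  proof -
    have bound: "norm (X (Suc n) t - X n t) \<le> 2 * M * G * (3 / 4) ^ n" for n
      using G[OF _ H[of n]] X(2) M t by (simp add: mult_ac)
    have "summable (\<lambda>n. 2 * M * G * (3 / 4) ^ n)"
      by (intro summable_mult summable_geometric) simp
    then have "summable (\<lambda>n. X (Suc n) t - X n t)"
      by (rule summable_comparison_test') (rule bound)
    then have "convergent (\<lambda>n. \<Sum>i<n. X (Suc i) t - X i t)"
      unfolding summable_iff_convergent .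
    then have "convergent (\<lambda>n. X n t - X 0 t)"
      unfolding sum_lessThan_telescope[of "\<lambda>i. X i t"] .
    then obtain l where "(\<lambda>n. X n t - X 0 t) \<longlonglongrightarrow> l"
      unfolding convergent_def ..
    from tendsto_add[OF this tendsto_const[of "X 0 t"]]
    have "(\<lambda>n. X n t) \<longlonglongrightarrow> l + X 0 t" by simp
    then show ?thesis unfolding x_def by (metis limI)
  qed
  define K where "K = 2 * D * M / (1 - 2 powr (1 - (1 + \<kappa>)))"
  have K: "K \<ge> 0"
    unfolding K_def using D M \<kappa> by (intro divide_nonneg_nonneg) (auto simp: powr_less_one less_imp_le)
  \<comment> \<open>The uniform rate of \<open>germ_estimate\<close> passes to the limit; pointwise
    convergence suffices because \<open>incr s t\<close> is continuous in space.\<close>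
  have est: "norm (x t - x s - incr s t (x s)) \<le> K * (t - s) powr (1 + \<kappa>)"
    if st: "0 \<le> s" "s \<le> t" "t \<le> T" for s t
  proof (rule LIMSEQ_le_const2)
    have "isCont (incr s t) (x s)"
      using has_derivative_continuous[OF incr_derivative[OF st]] .
    then have "(\<lambda>n. incr s t (X n s)) \<longlonglongrightarrow> incr s t (x s)"
      by (rule isCont_tendsto_compose) (rule lim, use st in auto)
    moreover have "(\<lambda>n. X (Suc n) s) \<longlonglongrightarrow> x s" "(\<lambda>n. X (Suc n) t) \<longlonglongrightarrow> x t"
      using st by (auto intro: LIMSEQ_Suc[OF lim])
    ultimately show "(\<lambda>n. norm (X (Suc n) t - X (Suc n) s - incr s t (X n s))) \<longlonglongrightarrow>
        norm (x t - x s - incr s t (x s))"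
      by (intro tendsto_norm tendsto_diff)
    show "\<exists>N. \<forall>n\<ge>N. norm (X (Suc n) t - X (Suc n) s - incr s t (X n s)) \<le> K * (t - s) powr (1 + \<kappa>)"
      using germ_estimate[OF germ_X X(1) st] by (auto simp: K_def)
  qed
  have "germ x x"
    unfolding germ_def
  proof (intro allI impI)
    fix \<epsilon> :: real assume "\<epsilon> > 0"
    then obtain \<delta> where \<delta>: "\<delta> > 0" "\<And>h. 0 \<le> h \<Longrightarrow> h < \<delta> \<Longrightarrow> K * h powr \<kappa> < \<epsilon>"
      using mult_powr_less[of \<epsilon> K \<kappa>] K \<kappa> by blast
    have "norm (x t - x s - incr s t (x s)) \<le> \<epsilon> * (t - s)"
      if st: "0 \<le> s" "s \<le> t" "t \<le> T" "t - s < \<delta>" for s t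
    proof -
      have "norm (x t - x s - incr s t (x s)) \<le> K * (t - s) powr (1 + \<kappa>)"
        using est st by blast
      also have "\<dots> = K * (t - s) powr \<kappa> * (t - s)"
        using st by (cases "s = t") (auto simp: powr_add)
      also have "\<dots> \<le> \<epsilon> * (t - s)"
        using \<delta>(2)[of "t - s"] st by (intro mult_right_mono) auto
      finally show ?thesis .
    qed
    with \<delta>(1) show "\<exists>\<delta>>0. \<forall>s t. 0 \<le> s \<longrightarrow> s \<le> t \<longrightarrow> t \<le> T \<longrightarrow> t - s < \<delta> \<longrightarrow>
        norm (x t - x s - incr s t (x s)) \<le> \<epsilon> * (t - s)"
      by blast
  qed
  moreover have "lip x"
    unfolding lip_def
  proof (intro allI impI)
    fix s t assume st: "0 \<le> s" "s \<le> t" "t \<le> T"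
    have "(\<lambda>n. norm (X n t - X n s)) \<longlonglongrightarrow> norm (x t - x s)"
      using lim st by (intro tendsto_norm tendsto_diff) auto
    then show "norm (x t - x s) \<le> M * (t - s)"
      by (rule LIMSEQ_le_const2) (use X(1) st in \<open>auto simp: lip_def\<close>)
  qed
  moreover have "x 0 = x0" by (simp add: x_def X(2))
  ultimately show ?thesis by blast
qed

text \<open>A fixed point is Lipschitz and solves the equation by
  \<open>germ_young_integral\<close>. Conversely, any solution \<open>y\<close> is continuous, so it
  has a Lipschitz primitive \<open>w\<close> along itself; uniqueness of Young integrals forces
  \<open>y = w\<close> on \<open>[0, T]\<close>, which reduces uniqueness to
  \<open>germ_unique\<close>.\<close>

lemma yde_solution_exists_unique:
  "\<exists>x. yde_solution T \<alpha> \<beta> A x0 x \<and> (\<forall>y. yde_solution T \<alpha> \<beta> A x0 y \<longrightarrow> (\<forall>t\<in>{0..T}. y t = x t))"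
proof -
  obtain x where x: "germ x x" "lip x" "x 0 = x0" using germ_exists by blast
  have "yde_solution T \<alpha> \<beta> A x0 x"
    unfolding yde_solution_def
  \<comment> \<open>With \<gamma> = 1 the Young condition reads \<alpha> + \<beta> > 1.\<close>
  proof (intro conjI exI[of _ 1])
    have "norm (x t) \<le> norm x0 + M * T" if t: "t \<in> {0..T}" for t
    proof -
      have "norm (x t) \<le> norm (x 0) + norm (x t - x 0)" by (rule norm_triangle_sub)
      also have "norm (x t - x 0) \<le> M * (t - 0)" using x(2) t unfolding lip_def by auto
      also have "M * (t - 0) \<le> M * T" using t M by simp
      finally show ?thesis using x(3) by simp
    qed
    moreover have "norm (x t - x s) \<le> M * (t - s) powr 1" if "s \<in> {0..T}" "t \<in> {0..T}" "s < t" for s t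
      using x(2) that unfolding lip_def by auto
    ultimately show "holder_path T 1 x" unfolding holder_path_def by blast
    show "\<forall>t\<in>{0..T}. young_integral_is A x 0 t (x t - x0)"
      using germ_young_integral[OF x(1)] x(3) by auto
  qed (use \<alpha>\<beta> in auto)
  moreover have "y t = x t" if y: "yde_solution T \<alpha> \<beta> A x0 y" and t: "t \<in> {0..T}" for y t
  proof -
    have "continuous_on {0..T} y"
      using y holder_path_continuous unfolding yde_solution_def by blast
    then obtain w where w: "germ y w" "lip w" "w 0 = x0" using primitive_exists by blast
    have eq: "y r = w r" if r: "0 \<le> r" "r \<le> T" for r
    proof -
      have "young_integral_is A y 0 r (w r - x0)" using germ_young_integral[OF w(1) r] w(3) by simp
      moreover have "young_integral_is A y 0 r (y r - x0)" using y r unfolding yde_solution_def by simp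
      ultimately have "w r - x0 = y r - x0" using young_integral_unique[OF r(1)] by blast
      then show ?thesis by simp
    qed
    \<comment> \<open>\<open>germ\<close> reads paths only on \<open>[0, T]\<close>, where
      \<open>y\<close> and \<open>w\<close> agree.\<close>
    have "germ w w \<longleftrightarrow> germ y w"
      unfolding germ_def using eq by (simp cong: imp_cong)
    with w(1) have "germ w w" by simp
    then have "w t = x t"
      by (rule germ_unique[OF _ w(2) x(1,2) _ t]) (simp add: w(3) x(3))
    with eq[of t] t show ?thesis by simp
  qed
  ultimately show ?thesis by blast
qed

end

section \<open>Extraction of the constants from the hypotheses\<close>

theorem mainTheorem4:
  fixes T \<alpha> \<beta> :: real
    and A :: "real \<Rightarrow> 'v::banach \<Rightarrow> 'v"
    and x0 :: 'v
  assumes "T > 0"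
    and "separable_space (euclidean :: 'v topology)"
    and "0 < \<alpha>" "\<alpha> < 1" "0 < \<beta>" "\<beta> < 1" "\<alpha> + \<beta> > 1"
    and "\<forall>x. A 0 x = 0"
    and "field_holder_1 T \<alpha> \<beta> A"
    and "\<exists>dA :: real \<Rightarrow> 'v \<Rightarrow> 'v.
           (\<forall>t\<in>{0..T}. \<forall>x. ((\<lambda>r. A r x) has_vector_derivative dA t x) (at t within {0..T})) \<and>
           continuous_on ({0..T} \<times> UNIV) (\<lambda>(t, x). dA t x) \<and>
           bounded ((\<lambda>(t, x). dA t x) ` ({0..T} \<times> UNIV))"
  shows "\<exists>x. yde_solution T \<alpha> \<beta> A x0 x \<and>
           (\<forall>y. yde_solution T \<alpha> \<beta> A x0 y \<longrightarrow> (\<forall>t\<in>{0..T}. y t = x t))"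
proof -
  obtain DA :: "real \<Rightarrow> 'v \<Rightarrow> 'v \<Rightarrow>\<^sub>L 'v" where
    DA: "\<forall>t\<in>{0..T}. \<forall>x. (A t has_derivative blinfun_apply (DA t x)) (at x)"
    and "field_holder T \<alpha> \<beta> DA"
    using \<open>field_holder_1 T \<alpha> \<beta> A\<close> unfolding field_holder_1_def by blast
  from this(2) obtain C where C: "\<forall>s\<in>{0..T}. \<forall>t\<in>{0..T}. s < t \<longrightarrow>
      (\<forall>x. norm (DA t x - DA s x) \<le> C * (t - s) powr \<alpha>) \<and>
      (\<forall>x y. x \<noteq> y \<longrightarrow> norm ((DA t x - DA s x) - (DA t y - DA s y)) \<le>
         C * (t - s) powr \<alpha> * norm (x - y) powr \<beta>)"
    unfolding field_holder_def by (elim exE)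
  \<comment> \<open>The absolute value supplies a nonnegative constant. If \<open>s = t\<close> or
    \<open>x = y\<close>, both sides vanish, as \<open>0 powr r = 0\<close>.\<close>
  have DA_holder: "norm ((DA t x - DA s x) - (DA t y - DA s y)) \<le>
      \<bar>C\<bar> * (t - s) powr \<alpha> * norm (x - y) powr \<beta>" if "0 \<le> s" "s \<le> t" "t \<le> T" for s t x y
  proof (cases "s = t \<or> x = y")
    case False
    then have "norm ((DA t x - DA s x) - (DA t y - DA s y)) \<le> C * (t - s) powr \<alpha> * norm (x - y) powr \<beta>"
      using C that by simp
    also have "\<dots> \<le> \<bar>C\<bar> * (t - s) powr \<alpha> * norm (x - y) powr \<beta>"
      by (intro mult_right_mono) auto
    finally show ?thesis .
  qed auto
  obtain dA :: "real \<Rightarrow> 'v \<Rightarrow> 'v" where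
    dA: "\<forall>t\<in>{0..T}. \<forall>x. ((\<lambda>r. A r x) has_vector_derivative dA t x) (at t within {0..T})"
      "continuous_on ({0..T} \<times> UNIV) (\<lambda>(t, x). dA t x)"
      "bounded ((\<lambda>(t, x). dA t x) ` ({0..T} \<times> UNIV))"
    using assms(10) by blast
  obtain M where M: "M > 0" "\<And>t x. t \<in> {0..T} \<Longrightarrow> norm (dA t x) \<le> M"
    using dA(3) unfolding bounded_pos by fastforce
  interpret time_regular_field T \<alpha> \<beta> M "\<bar>C\<bar>" A dA DA
    using assms DA DA_holder dA M by unfold_locales auto
  show ?thesis by (rule yde_solution_exists_unique)
qed

end
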